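(* Let $0 \in E \subseteq \mathbb{R}^+$. Then $E \in \mathbf{SSP}$ if and only if the inequality $\operatorname{card}(\Omega^{E}_{0, \tilde{r}}) \leq 2$ holds for every pretangent space $\Omega^{E}_{0, \tilde{r}}$ (that is, for every normalizing sequence $\tilde r$).
   Context: $\mathbb{R}^+=[0,\infty)$. For $T\subseteq\mathbb{R}^+$, $acT$ denotes the set of accumulation points of $T$ and $ExtT$ the exterior of $T$. A set $T\subseteq\mathbb{R}^+$ belongs to the family $\mathbf{SSP}$ if $0\notin acT$ or there is a sequence $\{(a_k,b_k)\}_{k\in\mathbb{N}}$ of open intervals $(a_k,b_k)\subseteq\mathbb{R}^+$ meeting the following conditions: (1) $a_k\ge b_{k+1}>a_{k+1}>0$ for each $k\in\mathbb{N}$; (2) every interval $(a_k,b_k)$ is a connected component of $ExtT$, i.e. $(a_k,b_k)\cap T=\emptyset$, but for every open interval $(a,b)\supseteq(a_k,b_k)$ with $(a,b)\ne(a_k,b_k)$ we have $(a,b)\cap T\neq\emptyset$; (3) $\lim_{k\to\infty}a_k=0$, $\lim_{k\to\infty}\frac{b_k-a_k}{b_k}=1$ and $\lim_{k\to\infty}\frac{b_{k+1}}{a_k}=1$. Pretangent spaces. A normalizing sequence is a sequence $\tilde r=(r_n)_{n\in\mathbb{N}}$ of positive real numbers tending to $0$. $\tilde E$ is the set of all sequences $(x_n)_{n\in\mathbb{N}}$ of points of $E$ with $\lim_{n\to\infty}x_n=0$. Two sequences $\tilde x=(x_n),\tilde y=(y_n)\in\tilde E$ are mutually stable w.r.t.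 $\tilde r$ if there is a finite limit $|\tilde x-\tilde y|_{\tilde r}:=\lim_{n\to\infty}|x_n-y_n|/r_n$. A family $\tilde F\subseteq\tilde E$ is self-stable if every two of its elements are mutually stable, and maximal self-stable if moreover for every $\tilde z\in\tilde E$ either $\tilde z\in\tilde F$ or there is $\tilde x\in\tilde F$ such that $\tilde x$ and $\tilde z$ are not mutually stable. $\tilde E_{0,\tilde r}$ denotes a maximal self-stable family containing the constant sequence $\tilde 0=(0,0,\dots)$; it exists and is unique (it consists of all $(x_n)\in\tilde E$ for which a finite limit $\lim_{n\to\infty} x_n/r_n$ exists). The pretangent space $\Omega^{E}_{0,\tilde r}$ is the metric identification of the pseudometric space $(\tilde E_{0,\tilde r},|\cdot-\cdot|_{\tilde r})$, i.e. the set of equivalence classes under $\tilde x\sim\tilde y\Leftrightarrow|\tilde x-\tilde y|_{\tilde r}=0$ with the induced metric. *)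

theory Defs
  imports "HOL-Analysis.Analysis"
begin

text \<open>
  The half-line of nonnegative reals is \<open>{0..} :: real set\<close>.
  For \<open>T \<subseteq> {0..}\<close> the exterior is taken in the space \<open>{0..}\<close>; as \<open>{0..}\<close> is closed in the
  reals, the closures of \<open>T\<close> in \<open>{0..}\<close> and in the reals agree.
\<close>

definition exterior :: "real set \<Rightarrow> real set" where
  "exterior T = {0..} - closure T"

text \<open>
  The sequences are indexed from 0.  Members of \<open>components S\<close> are nonempty, so the second
  conjunct forces \<open>a k < b k\<close> for every \<open>k\<close>, including \<open>k = 0\<close>.
\<close>

definition SSP :: "real set set" where
  "SSP = {T. T \<subseteq> {0..} \<and>
     (\<not> 0 islimpt T \<or>
      (\<exists>a b :: nat \<Rightarrow> real.
         (\<forall>k. a k \<ge> b (Suc k) \<and> b (Suc k) > a (Suc k) \<and> a (Suc k) > 0) \<and>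
         (\<forall>k. {a k<..<b k} \<in> components (exterior T)) \<and>
         a \<longlonglongrightarrow> 0 \<and>
         (\<lambda>k. (b k - a k) / b k) \<longlonglongrightarrow> 1 \<and>
         (\<lambda>k. b (Suc k) / a k) \<longlonglongrightarrow> 1))}"

text \<open>
  The elementary description of those components of the exterior that stay away from 0.
\<close>

lemma greaterThanLessThan_in_components_exterior_iff:
  fixes a b :: real
  assumes "0 < a"
  shows "{a<..<b} \<in> components (exterior T) \<longleftrightarrow>
    a < b \<and> {a<..<b} \<inter> T = {} \<and>
    (\<forall>c d. {a<..<b} \<subset> {c<..<d} \<longrightarrow> {c<..<d} \<inter> T \<noteq> {})"
proof
  assume L: "{a<..<b} \<in> components (exterior T)"
  have ab: "a < b" using in_components_nonempty[OF L] by simp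
  have sub: "{a<..<b} \<subseteq> exterior T" using in_components_subset[OF L] .
  have disj: "{a<..<b} \<inter> T = {}"
    using sub closure_subset[of T] by (auto simp: exterior_def)
  have mx: "{c<..<d} \<inter> T \<noteq> {}" if cd: "{a<..<b} \<subset> {c<..<d}" for c d
  proof
    assume e: "{c<..<d} \<inter> T = {}"
    have "{c<..<d} \<inter> closure T = {}"
      using e open_Int_closure_eq_empty[OF open_greaterThanLessThan] by blast
    then have s: "{max c 0<..<d} \<subseteq> exterior T"
      by (auto simp: exterior_def)
    have le: "c \<le> a" "b \<le> d" using cd ab greaterThanLessThan_subseteq_greaterThanLessThan[of a b c d] by auto
    have ne: "c < a \<or> b < d" using cd le by force
    have sup: "{a<..<b} \<subseteq> {max c 0<..<d}" using le assms by auto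
    have "{max c 0<..<d} = {a<..<b}"
      using L s sup ab unfolding in_components_maximal
      by (metis convex_connected convex_real_interval(8) greaterThanLessThan_empty_iff
          not_less subset_empty)
    then have "max c 0 = a \<and> d = b"
      using ab le assms greaterThanLessThan_subseteq_greaterThanLessThan[of "max c 0" d a b]
      by auto
    then show False using ne assms by auto
  qed
  show "a < b \<and> {a<..<b} \<inter> T = {} \<and>
    (\<forall>c d. {a<..<b} \<subset> {c<..<d} \<longrightarrow> {c<..<d} \<inter> T \<noteq> {})" using ab disj mx by blast
next
  assume R: "a < b \<and> {a<..<b} \<inter> T = {} \<and>
    (\<forall>c d. {a<..<b} \<subset> {c<..<d} \<longrightarrow> {c<..<d} \<inter> T \<noteq> {})"
  then have ab: "a < b" by simp
  have "{a<..<b} \<inter> closure T = {}"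
    using R open_Int_closure_eq_empty[OF open_greaterThanLessThan] by blast
  then have sub: "{a<..<b} \<subseteq> exterior T" using assms by (auto simp: exterior_def)
  have a_cl: "a \<in> closure T"
  proof (rule ccontr)
    assume "a \<notin> closure T"
    then obtain e where e: "e > 0" "\<And>y. y \<in> T \<Longrightarrow> \<not> dist y a < e"
      unfolding closure_approachable by blast
    have "{a - e<..<b} \<inter> T \<noteq> {}" using R e(1) ab
      by (metis (no_types, lifting) diff_less_eq greaterThanLessThan_iff
          greaterThanLessThan_subseteq_greaterThanLessThan less_add_same_cancel1 less_le_not_le psubsetI order_less_imp_le order_refl dense)
    then obtain y where y: "y \<in> T" "a - e < y" "y < b" by auto
    then have "y \<le> a" using R by force
    then have "dist y a < e" using y by (simp add: dist_real_def)
    then show False using e(2) y by blast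
  qed
  have b_cl: "b \<in> closure T"
  proof (rule ccontr)
    assume "b \<notin> closure T"
    then obtain e where e: "e > 0" "\<And>y. y \<in> T \<Longrightarrow> \<not> dist y b < e"
      unfolding closure_approachable by blast
    have "b \<in> {a<..<b + e}" "b \<notin> {a<..<b}" "{a<..<b} \<subseteq> {a<..<b + e}" using e(1) ab by auto
    then have "{a<..<b + e} \<inter> T \<noteq> {}" using R by blast
    then obtain y where y: "y \<in> T" "a < y" "y < b + e" by auto
    then have "b \<le> y" using R by force
    then have "dist y b < e" using y by (simp add: dist_real_def)
    then show False using e(2) y by blast
  qed
  have mx: "S = {a<..<b}" if S: "{a<..<b} \<subseteq> S" "S \<subseteq> exterior T" "connected S" for S
  proof -
    have m: "(a + b) / 2 \<in> S" using S(1) ab by (auto simp: field_simps)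
    have nab: "a \<notin> S" "b \<notin> S" using S(2) a_cl b_cl by (auto simp: exterior_def)
    have "x \<in> {a<..<b}" if x: "x \<in> S" for x
    proof (rule ccontr)
      assume "x \<notin> {a<..<b}"
      then consider "x \<le> a" | "b \<le> x" by force
      then show False
      proof cases
        case 1
        have "a \<in> S"
          using connectedD_interval[OF S(3) x m, of a] 1 ab by simp
        then show False using nab by simp
      next
        case 2
        have "b \<in> S"
          using connectedD_interval[OF S(3) m x, of b] 2 ab by simp
        then show False using nab by simp
      qed
    qed
    then show ?thesis using S(1) by auto
  qed
  show "{a<..<b} \<in> components (exterior T)"
    unfolding in_components_maximal using ab sub mx
    by (auto simp: convex_connected)
qed

definition normalizing :: "(nat \<Rightarrow> real) \<Rightarrow> bool" where
  "normalizing r \<longleftrightarrow> (\<forall>n. r n > 0) \<and> r \<longlonglongrightarrow> 0"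

definition null_seqs :: "real set \<Rightarrow> (nat \<Rightarrow> real) set" where
  "null_seqs E = {x. (\<forall>n. x n \<in> E) \<and> x \<longlonglongrightarrow> 0}"

definition mutually_stable :: "(nat \<Rightarrow> real) \<Rightarrow> (nat \<Rightarrow> real) \<Rightarrow> (nat \<Rightarrow> real) \<Rightarrow> bool" where
  "mutually_stable r x y \<longleftrightarrow> convergent (\<lambda>n. \<bar>x n - y n\<bar> / r n)"

definition stable_dist :: "(nat \<Rightarrow> real) \<Rightarrow> (nat \<Rightarrow> real) \<Rightarrow> (nat \<Rightarrow> real) \<Rightarrow> real" where
  "stable_dist r x y = lim (\<lambda>n. \<bar>x n - y n\<bar> / r n)"

definition self_stable :: "real set \<Rightarrow> (nat \<Rightarrow> real) \<Rightarrow> (nat \<Rightarrow> real) set \<Rightarrow> bool" where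
  "self_stable E r F \<longleftrightarrow> F \<subseteq> null_seqs E \<and> (\<forall>x\<in>F. \<forall>y\<in>F. mutually_stable r x y)"

definition maximal_self_stable :: "real set \<Rightarrow> (nat \<Rightarrow> real) \<Rightarrow> (nat \<Rightarrow> real) set \<Rightarrow> bool" where
  "maximal_self_stable E r F \<longleftrightarrow> self_stable E r F \<and>
     (\<forall>z\<in>null_seqs E. z \<in> F \<or> (\<exists>x\<in>F. \<not> mutually_stable r x z))"

text \<open>
  The metric identification of a family \<open>F\<close>: its points are the classes of sequences at
  distance 0, and the metric is the one induced by \<open>stable_dist r\<close> on representatives.
\<close>

definition identification :: "(nat \<Rightarrow> real) \<Rightarrow> (nat \<Rightarrow> real) set \<Rightarrow> (nat \<Rightarrow> real) set set" where
  "identification r F = F // {(x, y). x \<in> F \<and> y \<in> F \<and> stable_dist r x y = 0}"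

definition identification_dist ::
    "(nat \<Rightarrow> real) \<Rightarrow> (nat \<Rightarrow> real) set \<Rightarrow> (nat \<Rightarrow> real) set \<Rightarrow> real" where
  "identification_dist r A B = stable_dist r (SOME x. x \<in> A) (SOME y. y \<in> B)"

definition pretangent_space ::
    "real set \<Rightarrow> (nat \<Rightarrow> real) \<Rightarrow> (nat \<Rightarrow> real) set set \<Rightarrow>
     ((nat \<Rightarrow> real) set \<Rightarrow> (nat \<Rightarrow> real) set \<Rightarrow> real) \<Rightarrow> bool" where
  "pretangent_space E r \<Omega> d \<longleftrightarrow>
     (\<exists>F. maximal_self_stable E r F \<and> (\<lambda>n. 0) \<in> F \<and>
          \<Omega> = identification r F \<and> d = identification_dist r)"

text \<open>
  The family in the definition of a pretangent space exists and is unique.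
\<close>

lemma maximal_self_stable_zero_iff:
  assumes E: "0 \<in> E" "E \<subseteq> {0..}" and r: "normalizing r"
  shows "maximal_self_stable E r F \<and> (\<lambda>n. 0) \<in> F \<longleftrightarrow>
    F = {x \<in> null_seqs E. convergent (\<lambda>n. x n / r n)}"
proof -
  define G where "G = {x \<in> null_seqs E. convergent (\<lambda>n. x n / r n)}"
  have rpos: "r n > 0" for n using r by (simp add: normalizing_def)
  have zero: "(\<lambda>n. 0) \<in> G"
    using E(1) by (auto simp: G_def null_seqs_def convergent_const)
  have st0: "mutually_stable r (\<lambda>n. 0) x \<longleftrightarrow> convergent (\<lambda>n. x n / r n)"
       if "x \<in> null_seqs E" for x
  proof -
    have "x n \<ge> 0" for n using that E(2) by (auto simp: null_seqs_def)
    then have "\<bar>0 - x n\<bar> = x n" for n by simp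
    then show ?thesis by (simp add: mutually_stable_def)
  qed
  have stG: "mutually_stable r x y" if "x \<in> G" "y \<in> G" for x y
  proof -
    have "convergent (\<lambda>n. x n / r n - y n / r n)"
      using that by (intro convergent_diff) (auto simp: G_def)
    then have "convergent (\<lambda>n. \<bar>x n / r n - y n / r n\<bar>)"
      unfolding convergent_def using tendsto_rabs by blast
    moreover have "\<bar>x n / r n - y n / r n\<bar> = \<bar>x n - y n\<bar> / r n" for n
      using rpos[of n] by (simp add: abs_div_pos diff_divide_distrib)
    ultimately show ?thesis by (simp add: mutually_stable_def)
  qed
  have "maximal_self_stable E r G"
    using stG zero st0 unfolding maximal_self_stable_def self_stable_def
    by (auto simp: G_def)
  moreover have "F = G" if F: "maximal_self_stable E r F" "(\<lambda>n. 0) \<in> F"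
  proof
    show sub: "F \<subseteq> G"
      using F st0 unfolding maximal_self_stable_def self_stable_def G_def by blast
    show "G \<subseteq> F"
      using F(1) sub stG unfolding maximal_self_stable_def G_def by blast
  qed
  ultimately show ?thesis using zero unfolding G_def by blast
qed

text \<open>
  The induced metric does not depend on the chosen representatives.
\<close>

lemma identification_dist_class:
  assumes r: "normalizing r" and F: "self_stable E r F" and "x \<in> F" "y \<in> F"
  defines "R \<equiv> {(x, y). x \<in> F \<and> y \<in> F \<and> stable_dist r x y = 0}"
  shows "identification_dist r (R `` {x}) (R `` {y}) = stable_dist r x y"
proof -
  have rpos: "r n > 0" for n using r by (simp add: normalizing_def)
  have conv: "(\<lambda>n. \<bar>u n - v n\<bar> / r n) \<longlonglongrightarrow> stable_dist r u v" if "u \<in> F" "v \<in> F" for u v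
    using that F by (auto simp: self_stable_def mutually_stable_def stable_dist_def
        convergent_LIMSEQ_iff)
  have tri: "stable_dist r u w \<le> stable_dist r u v + stable_dist r v w"
    if "u \<in> F" "v \<in> F" "w \<in> F" for u v w
  proof (rule LIMSEQ_le)
    show "(\<lambda>n. \<bar>u n - v n\<bar> / r n + \<bar>v n - w n\<bar> / r n)
        \<longlonglongrightarrow> stable_dist r u v + stable_dist r v w"
      using that by (intro tendsto_add conv)
    have "\<bar>u n - w n\<bar> / r n \<le> \<bar>u n - v n\<bar> / r n + \<bar>v n - w n\<bar> / r n" for n
      unfolding add_divide_distrib[symmetric]
      by (rule divide_right_mono) (use rpos[of n] in auto)
    then show "\<exists>N. \<forall>n\<ge>N. \<bar>u n - w n\<bar> / r n \<le> \<bar>u n - v n\<bar> / r n + \<bar>v n - w n\<bar> / r n"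
      by blast
  qed (use that conv in blast)
  have sym: "stable_dist r u v = stable_dist r v u" for u v
    by (simp add: stable_dist_def abs_minus_commute)
  have refl: "stable_dist r u u = 0" for u
    by (simp add: stable_dist_def)
  define u where "u = (SOME u. u \<in> R `` {x})"
  define v where "v = (SOME v. v \<in> R `` {y})"
  have "x \<in> R `` {x}" "y \<in> R `` {y}" using assms(3,4) refl by (auto simp: R_def)
  then have "u \<in> R `` {x}" "v \<in> R `` {y}"
    unfolding u_def v_def
    using someI[of "\<lambda>u. u \<in> R `` {x}" x] someI[of "\<lambda>v. v \<in> R `` {y}" y] by blast+
  then have uv: "u \<in> F" "v \<in> F" "stable_dist r x u = 0" "stable_dist r y v = 0"
    by (auto simp: R_def)
  have "stable_dist r u v \<le> stable_dist r x y"
    using tri[of u x v] tri[of x y v] uv assms(3,4) sym[of u x] by simp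
  moreover have "stable_dist r x y \<le> stable_dist r u v"
    using tri[of x u y] tri[of u v y] uv assms(3,4) sym[of v y] by simp
  ultimately show ?thesis
    by (simp add: identification_dist_def u_def v_def)
qed

end

theory Submission
  imports Defs
begin

text \<open>
  Both sides say that the ratios \<open>y / x\<close> of pairs \<open>0 < x \<le> y\<close> in \<open>E\<close> accumulate
  only at \<open>1\<close> and \<open>\<infinity>\<close> as \<open>y\<close> tends to \<open>0\<close> (the predicate \<open>log_gapped\<close>).
  A pretangent space is isometric to the set of limits of \<open>x n / r n\<close> with \<open>x n \<in> E\<close>,
  which contains \<open>0\<close>; two further limits \<open>0 < s < t\<close> exhibit the ratio \<open>t / s\<close>, and conversely an
  accumulation value \<open>c\<close> of \<open>y n / x n\<close> gives the three limits \<open>0, 1, c\<close> for \<open>r = x\<close>.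
  If the ratios behave as described, then \<open>E\<close> falls near \<open>0\<close> into clusters that become
  logarithmically short and are separated by logarithmically long gaps; these gaps
  are the intervals required by \<open>SSP\<close>.
\<close>

text \<open>On a logarithmic scale: two positive points of \<open>E\<close> near \<open>0\<close>
  are either very close or very far apart. The free choice of \<open>q\<close> near \<open>1\<close>
  and of \<open>M\<close> large turns the statement on accumulating ratios into one without
  sequences.\<close>

definition log_gapped :: "real set \<Rightarrow> bool" where
  "log_gapped E \<longleftrightarrow> (\<forall>q>1. \<forall>M. \<exists>\<delta>>0. \<forall>x\<in>E. \<forall>y\<in>E.
     0 < x \<longrightarrow> x \<le> y \<longrightarrow> y < \<delta> \<longrightarrow> y \<le> q * x \<or> M * x \<le> y)"

lemma log_gappedE:
  assumes "log_gapped E" "1 < q"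
  obtains \<delta> where "0 < \<delta>"
    "\<And>x y. x \<in> E \<Longrightarrow> y \<in> E \<Longrightarrow> 0 < x \<Longrightarrow> x \<le> y \<Longrightarrow> y < \<delta> \<Longrightarrow> y \<le> q * x \<or> M * x \<le> y"
  using assms unfolding log_gapped_def by meson

section \<open>Pretangent spaces as sets of scaled limits\<close>

definition scaled_limits :: "real set \<Rightarrow> (nat \<Rightarrow> real) \<Rightarrow> real set" where
  "scaled_limits E r = {t. \<exists>x\<in>null_seqs E. (\<lambda>n. x n / r n) \<longlonglongrightarrow> t}"

text \<open>Sequences with scaled limits \<open>s\<close> and \<open>t\<close> are at stable
  distance \<open>\<bar>s - t\<bar>\<close>, so the classes of the identification are exactly the
  nonempty level sets of the limit. Counting points of a pretangent space thus becomes counting real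
  numbers.\<close>

lemma bij_betw_scaled_limits_pretangent:
  assumes E: "0 \<in> E" "E \<subseteq> {0..}" and r: "normalizing r"
    and \<Omega>: "pretangent_space E r \<Omega> d"
  shows "bij_betw (\<lambda>t. {x \<in> null_seqs E. (\<lambda>n. x n / r n) \<longlonglongrightarrow> t}) (scaled_limits E r) \<Omega>"
proof -
  let ?c = "\<lambda>t. {x \<in> null_seqs E. (\<lambda>n. x n / r n) \<longlonglongrightarrow> t}"
  obtain F where F: "maximal_self_stable E r F" "(\<lambda>n. 0) \<in> F" and \<Omega>_eq: "\<Omega> = identification r F"
    using \<Omega> by (auto simp: pretangent_space_def)
  then have F_eq: "F = {x \<in> null_seqs E. convergent (\<lambda>n. x n / r n)}"
    using maximal_self_stable_zero_iff[OF E r] by blast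
  have rpos: "r n > 0" for n using r by (simp add: normalizing_def)
  let ?R = "{(x, y). x \<in> F \<and> y \<in> F \<and> stable_dist r x y = 0}"
  have dist: "stable_dist r x y = \<bar>s - t\<bar>"
    if "(\<lambda>n. x n / r n) \<longlonglongrightarrow> s" "(\<lambda>n. y n / r n) \<longlonglongrightarrow> t" for x y s t
  proof -
    have "(\<lambda>n. \<bar>x n / r n - y n / r n\<bar>) \<longlonglongrightarrow> \<bar>s - t\<bar>"
      using that by (intro tendsto_rabs tendsto_diff)
    moreover have "\<bar>x n / r n - y n / r n\<bar> = \<bar>x n - y n\<bar> / r n" for n
      using rpos[of n] by (simp add: abs_div_pos diff_divide_distrib)
    ultimately show ?thesis
      by (simp add: stable_dist_def limI)
  qed
  have class_eq: "?R `` {x} = ?c t" if x: "x \<in> F" "(\<lambda>n. x n / r n) \<longlonglongrightarrow> t" for x t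
  proof (intro equalityI subsetI)
    fix y assume "y \<in> ?R `` {x}"
    then have y: "y \<in> F" "stable_dist r x y = 0" by auto
    then obtain s where s: "(\<lambda>n. y n / r n) \<longlonglongrightarrow> s" by (auto simp: F_eq convergent_def)
    then have "s = t" using dist[OF x(2) s] y(2) by simp
    then show "y \<in> ?c t" using s y(1) by (simp add: F_eq)
  next
    fix y assume y: "y \<in> ?c t"
    then have "y \<in> F" by (auto simp: F_eq convergent_def)
    moreover have "stable_dist r x y = 0" using dist[OF x(2), of y t] y by simp
    ultimately show "y \<in> ?R `` {x}" using x(1) by simp
  qed
  have "inj_on ?c (scaled_limits E r)"
  proof (rule inj_onI)
    fix s t assume "s \<in> scaled_limits E r" and eq: "?c s = ?c t"
    then obtain x where "x \<in> ?c s" by (auto simp: scaled_limits_def)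
    moreover from this have "x \<in> ?c t" using eq by blast
    ultimately show "s = t" by (auto intro: LIMSEQ_unique)
  qed
  moreover have "?c ` scaled_limits E r = \<Omega>"
  proof (intro equalityI subsetI)
    fix A assume "A \<in> ?c ` scaled_limits E r"
    then obtain t x where t: "A = ?c t" and x: "x \<in> null_seqs E" "(\<lambda>n. x n / r n) \<longlonglongrightarrow> t"
      by (auto simp: scaled_limits_def)
    then have "x \<in> F" by (auto simp: F_eq convergent_def)
    then show "A \<in> \<Omega>"
      using class_eq[of x t] t x by (auto simp: \<Omega>_eq identification_def quotient_def)
  next
    fix A assume "A \<in> \<Omega>"
    then obtain x where x: "x \<in> F" "A = ?R `` {x}"
      by (auto simp: \<Omega>_eq identification_def elim: quotientE)
    then obtain t where t: "(\<lambda>n. x n / r n) \<longlonglongrightarrow> t" by (auto simp: F_eq convergent_def)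
    then have "A = ?c t" "t \<in> scaled_limits E r"
      using class_eq[OF x(1) t] x by (auto simp: F_eq scaled_limits_def)
    then show "A \<in> ?c ` scaled_limits E r" by blast
  qed
  ultimately show ?thesis by (simp add: bij_betw_def)
qed

text \<open>This keeps a bound on all pretangent spaces from holding vacuously for some
  \<open>r\<close>.\<close>

lemma pretangent_space_exists:
  assumes "0 \<in> E" "E \<subseteq> {0..}" "normalizing r"
  shows "\<exists>\<Omega> d. pretangent_space E r \<Omega> d"
proof -
  let ?F = "{x \<in> null_seqs E. convergent (\<lambda>n. x n / r n)}"
  have "maximal_self_stable E r ?F \<and> (\<lambda>n. 0) \<in> ?F"
    using maximal_self_stable_zero_iff[OF assms, of ?F] by simp
  then show ?thesis unfolding pretangent_space_def by blast
qed

lemma scaled_limits_zero: "0 \<in> E \<Longrightarrow> 0 \<in> scaled_limits E r"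
  by (auto simp: scaled_limits_def null_seqs_def intro!: bexI[of _ "\<lambda>n. 0"])

lemma scaled_limits_nonneg:
  assumes "E \<subseteq> {0..}" "normalizing r" "t \<in> scaled_limits E r"
  shows "0 \<le> t"
proof -
  obtain x where x: "x \<in> null_seqs E" "(\<lambda>n. x n / r n) \<longlonglongrightarrow> t"
    using assms(3) by (auto simp: scaled_limits_def)
  have "0 \<le> x n / r n" for n
    using x(1) assms(1,2) unfolding null_seqs_def normalizing_def
    by (intro divide_nonneg_pos) auto
  then show ?thesis using x(2) by (intro LIMSEQ_le_const) auto
qed

section \<open>Ratio dichotomy and the number of scaled limits\<close>

text \<open>Two positive limits \<open>s < t\<close> would force the ratios \<open>y n / x n\<close>
  towards \<open>t / s\<close>, a value in the forbidden range between \<open>1\<close> and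
  infinity. Used in both orders, this leaves at most one positive limit.\<close>

lemma log_gapped_scaled_limits_unique:
  assumes E: "log_gapped E" and r: "normalizing r"
    and st: "s \<in> scaled_limits E r" "t \<in> scaled_limits E r" "0 < s"
  shows "\<not> s < t"
proof
  assume "s < t"
  obtain x y where x: "x \<in> null_seqs E" "(\<lambda>n. x n / r n) \<longlonglongrightarrow> s"
    and y: "y \<in> null_seqs E" "(\<lambda>n. y n / r n) \<longlonglongrightarrow> t"
    using st by (auto simp: scaled_limits_def)
  have rpos: "r n > 0" for n using r by (simp add: normalizing_def)
  have "1 < t / s" using \<open>s < t\<close> \<open>0 < s\<close> by simp
  \<comment> \<open>\<open>q\<close> and \<open>M\<close> enclose \<open>t / s\<close> strictly, so
    that the ratios eventually violate both alternatives of the dichotomy.\<close>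
  then obtain q where q: "1 < q" "q < t / s" using dense by blast
  obtain M where M: "t / s < M" using gt_ex by blast
  obtain \<delta> where \<delta>: "0 < \<delta>"
    "\<And>x y. x \<in> E \<Longrightarrow> y \<in> E \<Longrightarrow> 0 < x \<Longrightarrow> x \<le> y \<Longrightarrow> y < \<delta> \<Longrightarrow> y \<le> q * x \<or> M * x \<le> y"
    using log_gappedE[OF E q(1), of M] by blast
  have ratio: "(\<lambda>n. (y n / r n) / (x n / r n)) \<longlonglongrightarrow> t / s"
    using x(2) y(2) \<open>0 < s\<close> by (intro tendsto_divide) auto
  have "\<forall>\<^sub>F n in sequentially. 0 < x n / r n" using order_tendstoD(1)[OF x(2) \<open>0 < s\<close>] .
  moreover have "\<forall>\<^sub>F n in sequentially. q < (y n / r n) / (x n / r n)"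
    using order_tendstoD(1)[OF ratio q(2)] .
  moreover have "\<forall>\<^sub>F n in sequentially. (y n / r n) / (x n / r n) < M"
    using order_tendstoD(2)[OF ratio M] .
  moreover have "\<forall>\<^sub>F n in sequentially. y n < \<delta>"
    using y(1) \<delta>(1) by (auto simp: null_seqs_def intro: order_tendstoD(2))
  ultimately have "\<forall>\<^sub>F n in sequentially. False"
  proof eventually_elim
    case (elim n)
    have xn: "0 < x n" using elim(1) rpos[of n] by (simp add: zero_less_divide_iff)
    have qy: "q * x n < y n" and yM: "y n < M * x n"
      using elim(2,3) rpos[of n] xn by (auto simp: field_simps)
    have "x n \<le> y n" using mult_strict_right_mono[OF q(1) xn] qy by simp
    then show False
      using \<delta>(2)[of "x n" "y n"] xn elim(4) qy yM x(1) y(1) by (auto simp: null_seqs_def)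
  qed
  then show False by simp
qed

lemma log_gapped_card_scaled_limits:
  assumes E: "0 \<in> E" "E \<subseteq> {0..}" "log_gapped E" and r: "normalizing r"
  shows "finite (scaled_limits E r) \<and> card (scaled_limits E r) \<le> 2"
proof -
  have "\<exists>s. scaled_limits E r \<subseteq> {0, s}"
  proof (cases "\<exists>s\<in>scaled_limits E r. s \<noteq> 0")
    case True
    then obtain s where s: "s \<in> scaled_limits E r" "s \<noteq> 0" by blast
    have pos: "0 < t" if "t \<in> scaled_limits E r" "t \<noteq> 0" for t
      using scaled_limits_nonneg[OF E(2) r that(1)] that(2) by simp
    have "t = s" if "t \<in> scaled_limits E r" "t \<noteq> 0" for t
      using log_gapped_scaled_limits_unique[OF E(3) r] that s pos by (meson linorder_neqE)
    then show ?thesis by blast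
  qed blast
  then obtain s where s: "scaled_limits E r \<subseteq> {0, s}" by blast
  then have "card (scaled_limits E r) \<le> card {0, s}" by (intro card_mono) auto
  also have "\<dots> \<le> 2" by (simp add: card_insert_if)
  finally show ?thesis using s finite_subset by blast
qed

text \<open>If the dichotomy fails for some \<open>q\<close> and \<open>M\<close>, the offending
  pairs have ratios trapped between \<open>q\<close> and \<open>M\<close>. Normalizing by the
  smaller members produces a third scaled limit.\<close>

lemma card_scaled_limits_log_gapped:
  assumes "0 \<in> E"
    and card: "\<And>r. normalizing r \<Longrightarrow>
      finite (scaled_limits E r) \<and> card (scaled_limits E r) \<le> 2"
  shows "log_gapped E"
proof (rule ccontr)
  assume "\<not> log_gapped E"
  then obtain q M where q: "1 < q" and
    ex: "\<forall>\<delta>>0. \<exists>x y. x \<in> E \<and> y \<in> E \<and> 0 < x \<and> x \<le> y \<and> y < \<delta> \<and> q * x < y \<and> y < M * x"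
    unfolding log_gapped_def by (meson not_le)
  have "\<forall>n::nat. \<exists>x y. x \<in> E \<and> y \<in> E \<and> 0 < x \<and> x \<le> y \<and> y < 1 / Suc n \<and> q * x < y \<and> y < M * x"
    using ex by simp
  then obtain x y where xy: "\<And>n::nat. x n \<in> E" "\<And>n. y n \<in> E" "\<And>n. 0 < x n" "\<And>n. x n \<le> y n"
    "\<And>n. y n < 1 / Suc n" "\<And>n. q * x n < y n" "\<And>n. y n < M * x n"
    by metis
  have lim0: "(\<lambda>n. 1 / real (Suc n)) \<longlonglongrightarrow> 0"
    using LIMSEQ_inverse_real_of_nat by (simp add: inverse_eq_divide)
  have ypos: "0 < y n" for n using xy(3,4) less_le_trans by blast
  have y0: "y \<longlonglongrightarrow> 0"
    using ypos xy(5) by (intro tendsto_sandwich[OF _ _ tendsto_const lim0])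
      (auto intro!: always_eventually less_imp_le simp del: of_nat_Suc)
  have x0: "x \<longlonglongrightarrow> 0"
    using xy(3,4) by (intro tendsto_sandwich[OF _ _ tendsto_const y0])
      (auto intro!: always_eventually less_imp_le)
  have "\<forall>n. y n / x n \<in> {q..M}"
    using xy(3,6,7) by (auto simp: field_simps less_imp_le)
  \<comment> \<open>Compactness gives a limit ratio \<open>c\<close>; since
    \<open>c \<ge> q > 1\<close>, the numbers \<open>0\<close>, \<open>1\<close>, \<open>c\<close>
    are distinct.\<close>
  then obtain c \<sigma> where c: "c \<in> {q..M}" "strict_mono \<sigma>" "((\<lambda>n. y n / x n) \<circ> \<sigma>) \<longlonglongrightarrow> c"
    using compact_Icc[of q M] unfolding compact_def by meson
  let ?r = "x \<circ> \<sigma>"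
  have null: "x \<circ> \<sigma> \<in> null_seqs E" "y \<circ> \<sigma> \<in> null_seqs E"
    using xy(1,2) LIMSEQ_subseq_LIMSEQ[OF x0 c(2)] LIMSEQ_subseq_LIMSEQ[OF y0 c(2)]
    by (auto simp: null_seqs_def)
  have r: "normalizing ?r" using null(1) xy(3) by (simp add: normalizing_def null_seqs_def)
  have "(\<lambda>n. (x \<circ> \<sigma>) n / ?r n) = (\<lambda>n. 1)" using xy(3) by (auto simp: less_imp_neq[symmetric])
  then have one: "1 \<in> scaled_limits E ?r"
    unfolding scaled_limits_def using null(1) by (auto intro!: bexI[of _ "x \<circ> \<sigma>"])
  have "c \<in> scaled_limits E ?r"
    unfolding scaled_limits_def using null(2) c(3) by (auto simp: o_def intro!: bexI[of _ "y \<circ> \<sigma>"])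
  then have "{0, 1, c} \<subseteq> scaled_limits E ?r"
    using one scaled_limits_zero[OF assms(1)] by simp
  then have "card {0, 1, c} \<le> 2"
    using card[OF r] card_mono by (meson le_trans)
  then show False using c(1) q by simp
qed

section \<open>From a sequence of gaps to the ratio dichotomy\<close>

text \<open>Near \<open>0\<close> the set lies in the clusters \<open>[b (Suc k), a k]\<close>
  between consecutive gaps. Points of one cluster have ratio near \<open>1\<close> because
  \<open>b (Suc k) / a k\<close> tends to \<open>1\<close>; points of different clusters are
  separated by a gap with \<open>b k / a k\<close> large.\<close>

lemma SSP_log_gapped:
  assumes E: "E \<in> SSP"
  shows "log_gapped E"
proof (cases "0 islimpt E")
  case False
  then obtain \<delta> where \<delta>: "0 < \<delta>" "\<forall>x\<in>E. x \<noteq> 0 \<longrightarrow> \<delta> \<le> dist x 0"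
    by (auto simp: islimpt_approachable not_less)
  have "\<delta> \<le> x" if "x \<in> E" "0 < x" for x
    using \<delta>(2) that by (auto simp: dist_real_def)
  then show ?thesis unfolding log_gapped_def using \<delta>(1) by force
next
  case True
  then obtain a b :: "nat \<Rightarrow> real" where
    ord: "\<And>k. b (Suc k) \<le> a k" "\<And>k. a (Suc k) < b (Suc k)" "\<And>k. 0 < a (Suc k)"
    and comp: "\<And>k. {a k<..<b k} \<in> components (exterior E)"
    and lim: "a \<longlonglongrightarrow> 0" "(\<lambda>k. (b k - a k) / b k) \<longlonglongrightarrow> 1" "(\<lambda>k. b (Suc k) / a k) \<longlonglongrightarrow> 1"
    using E unfolding SSP_def by auto
  \<comment> \<open>Positivity of \<open>a 0\<close>, absent from \<open>ord\<close>, follows from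
    \<open>a 0 \<ge> b 1 > a 1 > 0\<close>.\<close>
  have apos: "0 < a k" for k using ord[of k] by linarith
  have ab: "a k < b k" for k using in_components_nonempty[OF comp[of k]] by simp
  have gap: "x \<notin> E" if "a k < x" "x < b k" for x k
    using greaterThanLessThan_in_components_exterior_iff[OF apos, of k "b k" E] comp[of k] that
    by auto
  have "decseq a" using ord by (intro decseq_SucI) (meson less_imp_le order_trans)
  have "decseq b" using ord(1) ab by (intro decseq_SucI) (meson less_imp_le order_trans)
  \<comment> \<open>The least index with \<open>a k < x\<close> exists since \<open>a\<close> tends
    to \<open>0\<close>, and it is not \<open>0\<close> since \<open>x < a K \<le> a 0\<close>. Its
    predecessor names the cluster of \<open>x\<close>.\<close>
  have locate: "\<exists>k\<ge>K. b (Suc k) \<le> x \<and> x \<le> a k" if x: "x \<in> E" "0 < x" "x < a K" for x K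
  proof -
    have "\<exists>k. a k < x"
      using order_tendstoD(2)[OF lim(1) x(2)] by (auto simp: eventually_sequentially)
    then have m: "a (LEAST k. a k < x) < x" by (rule LeastI_ex)
    obtain k where k: "(LEAST k. a k < x) = Suc k"
      using m x(3) \<open>decseq a\<close>[THEN decseqD, of 0 K] by (cases "LEAST k. a k < x") auto
    have "\<not> a k < x" using not_less_Least[of k "\<lambda>k. a k < x"] k by simp
    moreover have "b (Suc k) \<le> x" using gap[of "Suc k" x] m k x(1) by force
    moreover have "K \<le> k" using m k x(3) \<open>decseq a\<close>[THEN decseqD, of "Suc k" K] by force
    ultimately show ?thesis by force
  qed
  show ?thesis
    unfolding log_gapped_def
  proof (intro allI impI)
    fix q M :: real assume q: "1 < q"
    have "(b k - a k) / b k = 1 - a k / b k" for k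
      using ab[of k] apos[of k] by (simp add: diff_divide_distrib)
    then have "(\<lambda>k. 1 - (b k - a k) / b k) = (\<lambda>k. a k / b k)" by simp
    then have "(\<lambda>k. a k / b k) \<longlonglongrightarrow> 0"
      using tendsto_diff[OF tendsto_const[of 1] lim(2)] by simp
    \<comment> \<open>\<open>M\<close> is arbitrary; \<open>max M 1\<close> makes the threshold
      positive.\<close>
    then have "\<forall>\<^sub>F k in sequentially. a k / b k < 1 / max M 1"
      by (rule order_tendstoD(2)) simp
    moreover have "\<forall>\<^sub>F k in sequentially. 1 / q < b (Suc k) / a k"
      using q by (intro order_tendstoD(1)[OF lim(3)]) simp
    ultimately have "\<forall>\<^sub>F k in sequentially. a k / b k < 1 / max M 1 \<and> 1 / q < b (Suc k) / a k"
      by eventually_elim simp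
    then obtain K where K: "\<And>k. K \<le> k \<Longrightarrow> a k / b k < 1 / max M 1"
      "\<And>k. K \<le> k \<Longrightarrow> 1 / q < b (Suc k) / a k"
      by (auto simp: eventually_sequentially)
    have long: "M * a k \<le> b k" if "K \<le> k" for k
    proof -
      have "max M 1 * a k < b k"
        using K(1)[OF that] apos[of k] ab[of k] by (simp add: field_simps)
      moreover have "M * a k \<le> max M 1 * a k" using apos[of k] by (intro mult_right_mono) auto
      ultimately show ?thesis by simp
    qed
    have short: "a k \<le> q * b (Suc k)" if "K \<le> k" for k
      using K(2)[OF that] apos[of k] q by (simp add: field_simps)
    have "y \<le> q * x \<or> M * x \<le> y" if xy: "x \<in> E" "y \<in> E" "0 < x" "x \<le> y" "y < a K" for x y
    proof -
      obtain k where k: "K \<le> k" "b (Suc k) \<le> x" "x \<le> a k" using locate[of x K] xy by auto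
      obtain m where m: "K \<le> m" "b (Suc m) \<le> y" "y \<le> a m" using locate[of y K] xy by auto
      show ?thesis
      \<comment> \<open>For \<open>k \<le> m\<close> both points lie between
        \<open>b (Suc k)\<close> and \<open>a k\<close>. Otherwise the whole gap from
        \<open>a k\<close> to \<open>b k\<close> separates \<open>x\<close> from
        \<open>y\<close>.\<close>
      proof (cases "k \<le> m")
        case True
        then have "y \<le> a k" using m(3) \<open>decseq a\<close>[THEN decseqD, of k m] by simp
        also have "\<dots> \<le> q * b (Suc k)" using short k(1) .
        also have "\<dots> \<le> q * x" using k(2) q by simp
        finally show ?thesis by simp
      next
        case False
        show ?thesis
        proof (cases "M \<le> 0")
          case True
          then have "M * x \<le> 0" using xy(3) by (simp add: mult_nonpos_nonneg)
          then show ?thesis using xy(3,4) by simp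
        next
          case False
          then have "M * x \<le> M * a k" using k(3) by simp
          also have "\<dots> \<le> b k" using long k(1) .
          also have "\<dots> \<le> b (Suc m)" using \<open>\<not> k \<le> m\<close> \<open>decseq b\<close>[THEN decseqD, of "Suc m" k] by simp
          finally show ?thesis using m(2) by simp
        qed
      qed
    qed
    then show "\<exists>\<delta>>0. \<forall>x\<in>E. \<forall>y\<in>E. 0 < x \<longrightarrow> x \<le> y \<longrightarrow> y < \<delta> \<longrightarrow> y \<le> q * x \<or> M * x \<le> y"
      using apos[of K] by blast
  qed
qed

section \<open>Construction of the gaps from the ratio dichotomy\<close>

text \<open>The threshold \<open>x / 2\<close> splits \<open>E\<close>, and the gap is what the
  split leaves free. Its ends are a supremum and an infimum of points of \<open>E\<close>, so a
  larger open interval catches a point near the end that it passes.\<close>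

lemma gap_in_components_exterior:
  fixes E :: "real set"
  defines "p \<equiv> \<lambda>x. Sup {y \<in> E. y < x / 2}" and "b \<equiv> \<lambda>x. Inf {y \<in> E. x / 2 \<le> y}"
  assumes x: "x \<in> E" "0 < x" and p: "0 < p x" "p x < b x"
    and ne: "\<exists>y\<in>E. y < x / 2"
  shows "{p x<..<b x} \<in> components (exterior E)"
  unfolding greaterThanLessThan_in_components_exterior_iff[OF p(1)]
proof (intro conjI allI impI)
  let ?P = "{y \<in> E. y < x / 2}" and ?B = "{y \<in> E. x / 2 \<le> y}"
  have P: "?P \<noteq> {}" "bdd_above ?P" using ne by (auto intro!: bdd_aboveI[of _ "x / 2"])
  have B: "?B \<noteq> {}" "bdd_below ?B" using x by (auto intro!: bdd_belowI[of _ "x / 2"])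
  show "p x < b x" by (fact p)
  have up: "y \<le> p x" if "y \<in> ?P" for y unfolding p_def using that P(2) by (rule cSup_upper)
  have lo: "b x \<le> y" if "y \<in> ?B" for y unfolding b_def using that B(2) by (rule cInf_lower)
  show "{p x<..<b x} \<inter> E = {}" using up lo by force
  fix c d assume "{p x<..<b x} \<subset> {c<..<d}"
  then have cd: "c \<le> p x" "b x \<le> d" "c < p x \<or> b x < d"
    using p(2) greaterThanLessThan_subseteq_greaterThanLessThan[of "p x" "b x" c d]
    by (auto simp: psubset_eq)
  show "{c<..<d} \<inter> E \<noteq> {}"
  proof (cases "c < p x")
    case True
    then obtain y where "y \<in> ?P" "c < y" unfolding p_def using less_cSupD[OF P(1)] by blast
    then show ?thesis using up[of y] cd(2) p(2) by force
  next
    case False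
    then have "b x < d" using cd(3) by simp
    then obtain y where "y \<in> ?B" "y < d" unfolding b_def using cInf_lessD[OF B(1)] by blast
    then show ?thesis using lo[of y] cd(1) p(2) by force
  qed
qed

text \<open>Each gap is taken around half of a point \<open>x k\<close> of \<open>E\<close>, and the
  next point is chosen just below that gap. The dichotomy with large \<open>M\<close> makes the gaps
  long, and with \<open>q\<close> near \<open>1\<close> it makes the clusters between them
  short.\<close>

lemma log_gapped_SSP:
  assumes E: "E \<subseteq> {0..}" "log_gapped E"
  shows "E \<in> SSP"
proof (cases "0 islimpt E")
  case False
  then show ?thesis using E(1) by (simp add: SSP_def)
next
  case True
  define p where "p x = Sup {y \<in> E. y < x / 2}" for x
  define b where "b x = Inf {y \<in> E. x / 2 \<le> y}" for x
  have ex: "\<exists>y\<in>E. 0 < y \<and> y < e" if e: "0 < e" for e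
  proof -
    obtain y where "y \<in> E" "y \<noteq> 0" "dist y 0 < e"
      using True e unfolding islimpt_approachable by blast
    then show ?thesis using E(1) by (auto simp: dist_real_def intro!: bexI[of _ y])
  qed
  have bdd: "bdd_above {y \<in> E. y < x / 2}" "bdd_below {y \<in> E. x / 2 \<le> y}" for x
    by (auto intro!: bdd_aboveI[of _ "x / 2"] bdd_belowI[of _ "x / 2"])
  have p_upper: "y \<le> p x" if "y \<in> E" "y < x / 2" for x y
    unfolding p_def using that bdd by (intro cSup_upper) auto
  have b_lower: "b x \<le> y" if "y \<in> E" "x / 2 \<le> y" for x y
    unfolding b_def using that bdd by (intro cInf_lower) auto
  have p_le: "p x \<le> z" if "0 < x" "\<And>y. y \<in> E \<Longrightarrow> y < x / 2 \<Longrightarrow> y \<le> z" for x z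
    unfolding p_def using ex[of "x / 2"] that by (intro cSup_least) auto
  have b_ge: "z \<le> b x" if "x \<in> E" "0 < x" "\<And>y. y \<in> E \<Longrightarrow> x / 2 \<le> y \<Longrightarrow> z \<le> y" for x z
    unfolding b_def using that by (intro cInf_greatest) auto
  have p_pos: "0 < p x" if "0 < x" for x
    using ex[of "x / 2"] p_upper that by (force intro: less_le_trans)
  have b_half: "x / 2 \<le> b x" if "x \<in> E" "0 < x" for x
    by (rule b_ge) (use that in auto)
  \<comment> \<open>The supremum \<open>p x\<close> need not belong to \<open>E\<close>; a point of
    \<open>E\<close> within a factor 2 of it serves instead.\<close>
  have next_pt: "\<exists>y\<in>E. p x / 2 < y \<and> y \<le> p x \<and> y < x / 2" if "0 < x" for x
  proof -
    have "p x / 2 < Sup {y \<in> E. y < x / 2}" using p_pos[OF that] by (simp add: p_def)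
    moreover have "{y \<in> E. y < x / 2} \<noteq> {}" using ex[of "x / 2"] that by auto
    ultimately obtain y where "y \<in> E" "y < x / 2" "p x / 2 < y"
      using less_cSupD[of "{y \<in> E. y < x / 2}" "p x / 2"] by auto
    then show ?thesis using p_upper by blast
  qed
  \<comment> \<open>For \<open>y < x / 2\<close> the alternative \<open>x \<le> 2 * y\<close> fails,
    so the dichotomy with \<open>q = 2\<close> bounds every such \<open>y\<close>, hence their
    supremum, by \<open>x / M\<close>.\<close>
  have sparse: "\<exists>\<delta>>0. \<forall>x\<in>E. 0 < x \<and> x < \<delta> \<longrightarrow> M * p x \<le> x" if "0 < M" for M
  proof -
    obtain \<delta> where \<delta>: "0 < \<delta>"
      "\<And>x y. x \<in> E \<Longrightarrow> y \<in> E \<Longrightarrow> 0 < x \<Longrightarrow> x \<le> y \<Longrightarrow> y < \<delta> \<Longrightarrow> y \<le> 2 * x \<or> M * x \<le> y"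
      using log_gappedE[OF E(2), of 2 M] by auto
    have "M * p x \<le> x" if x: "x \<in> E" "0 < x" "x < \<delta>" for x
    proof -
      have "p x \<le> x / M"
      proof (rule p_le[OF x(2)])
        fix y assume y: "y \<in> E" "y < x / 2"
        show "y \<le> x / M"
        proof (cases "0 < y")
          case True
          then have "M * y \<le> x" using \<delta>(2)[of y x] y x by auto
          then show ?thesis using \<open>0 < M\<close> by (simp add: field_simps)
        next
          case False
          then show ?thesis using \<open>0 < M\<close> x(2) by (smt (verit) divide_pos_pos)
        qed
      qed
      then show ?thesis using \<open>0 < M\<close> by (simp add: field_simps)
    qed
    then show ?thesis using \<delta>(1) by blast
  qed
  \<comment> \<open>The factor 3 yields \<open>p x \<le> x / 3 < x / 2 \<le> b x\<close>, so the gap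
    is nonempty.\<close>
  obtain \<delta> where \<delta>: "0 < \<delta>" "\<And>x. x \<in> E \<Longrightarrow> 0 < x \<Longrightarrow> x < \<delta> \<Longrightarrow> 3 * p x \<le> x"
    using sparse[of 3] by auto
  obtain x0 where x0: "x0 \<in> E" "0 < x0" "x0 < \<delta>" using ex[OF \<delta>(1)] by blast
  obtain x where x: "\<And>k::nat. x k \<in> E \<and> 0 < x k \<and> x k < \<delta>"
    and step: "\<And>k. p (x k) / 2 < x (Suc k) \<and> x (Suc k) \<le> p (x k) \<and> x (Suc k) < x k / 2"
  proof -
    have "\<exists>y. (y \<in> E \<and> 0 < y \<and> y < \<delta>) \<and> (p z / 2 < y \<and> y \<le> p z \<and> y < z / 2)"
      if z: "z \<in> E \<and> 0 < z \<and> z < \<delta>" for z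
      using next_pt[of z] p_pos[of z] z by force
    then show ?thesis
      using dependent_nat_choice[of "\<lambda>_ y. y \<in> E \<and> 0 < y \<and> y < \<delta>"
          "\<lambda>_ z y. p z / 2 < y \<and> y \<le> p z \<and> y < z / 2"] x0 that by (metis (lifting))
  qed
  have xE: "x k \<in> E" and xpos: "0 < x k" and x\<delta>: "x k < \<delta>" for k using x by auto
  have x_geom: "x k \<le> x 0 * (1 / 2) ^ k" for k
  proof (induction k)
    case (Suc k)
    then show ?case using step[of k] by simp
  qed simp
  have x_lim: "x \<longlonglongrightarrow> 0"
  proof (rule tendsto_sandwich[OF _ _ tendsto_const])
    show "\<forall>\<^sub>F k in sequentially. 0 \<le> x k"
      by (intro always_eventually allI less_imp_le xpos)
    show "\<forall>\<^sub>F k in sequentially. x k \<le> x 0 * (1 / 2) ^ k"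
      by (intro always_eventually allI x_geom)
    show "(\<lambda>k. x 0 * (1 / 2) ^ k) \<longlonglongrightarrow> 0"
      by (intro tendsto_mult_right_zero LIMSEQ_power_zero) simp
  qed
  have p_half: "p (x k) \<le> x k / 2" for k
    by (rule p_le) (use xpos[of k] in auto)
  have pb: "p (x k) < b (x k)" for k
    using \<delta>(2)[of "x k"] xE xpos[of k] x\<delta> b_half[of "x k"] by fastforce
  \<comment> \<open>\<open>x (Suc k)\<close> itself competes in the infimum
    \<open>b (x (Suc k))\<close> and lies below \<open>p (x k)\<close>.\<close>
  have bp: "b (x (Suc k)) \<le> p (x k)" for k
    using b_lower[of "x (Suc k)" "x (Suc k)"] xE xpos[of "Suc k"] step[of k] by fastforce
  have bpos: "0 < b (x k)" for k
    using b_half[of "x k"] xE xpos[of k] by fastforce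
  have comp: "{p (x k)<..<b (x k)} \<in> components (exterior E)" for k
    using gap_in_components_exterior[of "x k" E] xE xpos[of k] p_pos[of "x k"] pb[of k] ex[of "x k / 2"]
    unfolding p_def b_def by auto
  have p_lim: "(\<lambda>k. p (x k)) \<longlonglongrightarrow> 0"
  proof (rule tendsto_sandwich[OF _ _ tendsto_const])
    show "\<forall>\<^sub>F k in sequentially. 0 \<le> p (x k)"
      by (intro always_eventually allI less_imp_le p_pos xpos)
    show "\<forall>\<^sub>F k in sequentially. p (x k) \<le> x k / 2"
      by (intro always_eventually allI p_half)
    show "(\<lambda>k. x k / 2) \<longlonglongrightarrow> 0" by (rule tendsto_divide_zero[OF x_lim])
  qed
  have "(\<lambda>k. p (x k) / b (x k)) \<longlonglongrightarrow> 0"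
  proof (rule LIMSEQ_I)
    fix e :: real assume "0 < e"
    then obtain \<eta> where \<eta>: "0 < \<eta>" "\<forall>z\<in>E. 0 < z \<and> z < \<eta> \<longrightarrow> (4 / e) * p z \<le> z"
      \<comment> \<open>One factor 2 is lost in \<open>x k \<le> 2 * b (x k)\<close>; the other
        makes the final estimate strict.\<close>
      using sparse[of "4 / e"] by auto
    obtain K where K: "\<And>k. K \<le> k \<Longrightarrow> x k < \<eta>"
      using order_tendstoD(2)[OF x_lim \<eta>(1)] by (auto simp: eventually_sequentially)
    have "norm (p (x k) / b (x k) - 0) < e" if "K \<le> k" for k
    proof -
      have "(4 / e) * p (x k) \<le> x k" using \<eta>(2) K[OF that] xE xpos by blast
      then have "4 * p (x k) \<le> e * x k" using \<open>0 < e\<close> by (simp add: field_simps)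
      also have "\<dots> \<le> e * (2 * b (x k))"
        using b_half[of "x k"] xE xpos[of k] \<open>0 < e\<close> by (intro mult_left_mono) auto
      finally have "p (x k) < e * b (x k)" using p_pos[OF xpos[of k]] by simp
      then show ?thesis using bpos[of k] p_pos[OF xpos[of k]] by (simp add: field_simps)
    qed
    then show "\<exists>K. \<forall>k\<ge>K. norm (p (x k) / b (x k) - 0) < e" by blast
  qed
  then have "(\<lambda>k. 1 - p (x k) / b (x k)) \<longlonglongrightarrow> 1"
    using tendsto_diff[OF tendsto_const[of 1]] by fastforce
  moreover have "(b (x k) - p (x k)) / b (x k) = 1 - p (x k) / b (x k)" for k
    using bpos[of k] by (simp add: diff_divide_distrib)
  ultimately have lim1: "(\<lambda>k. (b (x k) - p (x k)) / b (x k)) \<longlonglongrightarrow> 1" by simp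
  have lim2: "(\<lambda>k. b (x (Suc k)) / p (x k)) \<longlonglongrightarrow> 1"
  proof (rule order_tendstoI)
    fix e :: real assume "1 < e"
    then show "\<forall>\<^sub>F k in sequentially. b (x (Suc k)) / p (x k) < e"
      using bp p_pos[OF xpos] by (intro always_eventually allI) (smt (verit) divide_le_eq_1_pos)
  next
    fix e :: real assume e: "e < 1"
    \<comment> \<open>\<open>1 / q\<close> is the midpoint of \<open>max e 0\<close> and
      \<open>1\<close>, hence strictly above \<open>e\<close>; the maximum covers negative
      \<open>e\<close>.\<close>
    define q where "q = 2 / (1 + max e 0)"
    have q: "1 < q" "e * q < 1"
      using e by (auto simp: q_def field_simps max_def)
    obtain \<eta> where \<eta>: "0 < \<eta>"
      "\<And>y z. y \<in> E \<Longrightarrow> z \<in> E \<Longrightarrow> 0 < y \<Longrightarrow> y \<le> z \<Longrightarrow> z < \<eta> \<Longrightarrow> z \<le> q * y \<or> 5 * y \<le> z"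
      \<comment> \<open>The constant 5 rules out the second alternative: below,
        \<open>z \<le> p (x k) < 2 * x (Suc k) \<le> 4 * y\<close>.\<close>
      using log_gappedE[OF E(2) q(1), of 5] by auto
    have "\<forall>\<^sub>F k in sequentially. x k < \<eta>"
      using order_tendstoD(2)[OF x_lim \<eta>(1)] .
    then show "\<forall>\<^sub>F k in sequentially. e < b (x (Suc k)) / p (x k)"
    proof eventually_elim
      case (elim k)
      \<comment> \<open>Every \<open>z\<close> in \<open>E\<close> below \<open>x k / 2\<close> is
        compared with every \<open>y\<close> in \<open>E\<close> from \<open>x (Suc k) / 2\<close>
        on; supremum over \<open>z\<close> and infimum over \<open>y\<close> then give the
        bound.\<close>
      have "p (x k) / q \<le> b (x (Suc k))"
      proof (rule b_ge[OF xE xpos])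
        fix y assume y: "y \<in> E" "x (Suc k) / 2 \<le> y"
        have ypos: "0 < y" using y(2) xpos[of "Suc k"] by simp
        have "p (x k) \<le> q * y"
        proof (rule p_le[OF xpos])
          fix z assume z: "z \<in> E" "z < x k / 2"
          have "z < 5 * y" using p_upper[OF z] step[of k] y(2) ypos by simp
          have yq: "y \<le> q * y"
            using mult_right_mono[of 1 q y] q(1) ypos by simp
          show "z \<le> q * y"
          proof (cases "y \<le> z")
            case True
            have "z < \<eta>" using z(2) elim xpos[of k] by simp
            then show ?thesis using \<eta>(2)[OF y(1) z(1) ypos True] \<open>z < 5 * y\<close> by simp
          next
            case False
            then show ?thesis using yq by simp
          qed
        qed
        then show "p (x k) / q \<le> y" using q(1) by (simp add: field_simps)
      qed
      then have "1 / q \<le> b (x (Suc k)) / p (x k)"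
        using q(1) p_pos[OF xpos[of k]] by (simp add: field_simps)
      moreover have "e < 1 / q" using q by (simp add: field_simps)
      ultimately show ?case by simp
    qed
  qed
  have "(\<forall>k. b (x (Suc k)) \<le> p (x k) \<and> p (x (Suc k)) < b (x (Suc k)) \<and> 0 < p (x (Suc k)))"
    using bp pb p_pos[OF xpos] by blast
  then show ?thesis
    unfolding SSP_def using E(1) comp p_lim lim1 lim2
    by (intro CollectI conjI disjI2 exI[of _ "\<lambda>k. p (x k)"] exI[of _ "\<lambda>k. b (x k)"]) auto
qed

theorem theorem5p31:
  fixes E :: "real set"
  assumes "0 \<in> E" and "E \<subseteq> {0..}"
  shows "E \<in> SSP \<longleftrightarrow>
    (\<forall>r \<Omega> d. normalizing r \<and> pretangent_space E r \<Omega> d \<longrightarrow> finite \<Omega> \<and> card \<Omega> \<le> 2)"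
proof -
  \<comment> \<open>Finiteness is carried along because \<open>card\<close> is \<open>0\<close> on
    infinite sets.\<close>
  have transfer: "finite \<Omega> \<and> card \<Omega> \<le> 2 \<longleftrightarrow>
      finite (scaled_limits E r) \<and> card (scaled_limits E r) \<le> 2"
    if "normalizing r" "pretangent_space E r \<Omega> d" for r \<Omega> d
    using bij_betw_finite[OF bij_betw_scaled_limits_pretangent[OF assms that]]
      bij_betw_same_card[OF bij_betw_scaled_limits_pretangent[OF assms that]] by simp
  have "E \<in> SSP \<longleftrightarrow> log_gapped E"
    using SSP_log_gapped log_gapped_SSP[OF assms(2)] by blast
  also have "\<dots> \<longleftrightarrow> (\<forall>r. normalizing r \<longrightarrow>
      finite (scaled_limits E r) \<and> card (scaled_limits E r) \<le> 2)"
    using log_gapped_card_scaled_limits[OF assms] card_scaled_limits_log_gapped[OF assms(1)] by blast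
  also have "\<dots> \<longleftrightarrow>
      (\<forall>r \<Omega> d. normalizing r \<and> pretangent_space E r \<Omega> d \<longrightarrow> finite \<Omega> \<and> card \<Omega> \<le> 2)"
    using transfer pretangent_space_exists[OF assms] by blast
  finally show ?thesis .
qed

end
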